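(* Let $a_{jk}(t)$ ($j,k=1,2$) be real-valued continuous functions on $[t_0,+\infty)$, where $a_{12}$ and $a_{21}$ have unbounded supports, and let $a_{12}(t)\ge0$, $a_{21}(t)\ge0$ for all $t\ge t_0$. Then for an arbitrary solution $(\phi(t),\psi(t))$ of the system $$\phi'=a_{11}(t)\phi+a_{12}(t)\psi,\qquad \psi'=a_{21}(t)\phi+a_{22}(t)\psi,\qquad t\ge t_0,$$ there exist constants $C_1(\phi;\psi)$, $C_2(\phi;\psi)$ depending on the solution such that for all $t\ge t_0$ $$|\phi(t)|\le C_1(\phi;\psi)\exp\Big\{\int_{t_0}^t\big[a_{11}(\tau)+a_{12}(\tau)I^-_{B,a_{21}}(t_0;\tau)\big]d\tau\Big\},$$ $$|\psi(t)|\le C_2(\phi;\psi)\exp\Big\{\int_{t_0}^t\big[a_{22}(\tau)+a_{21}(\tau)I^-_{-B,a_{12}}(t_0;\tau)\big]d\tau\Big\}.$$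
   Context: All solutions are real-valued. $B(t)=a_{11}(t)-a_{22}(t)$. For continuous functions $u,v$ on $[t_0,+\infty)$: $J_u(t_1;t)=\exp\{\int_{t_1}^t u(\tau)d\tau\}$ and $I^-_{u,v}(t_1;t)=\int_{t_1}^t J_{-u}(\tau;t)\,v(\tau)\,d\tau$. *)

theory Defs
  imports "HOL-Analysis.Analysis"
begin

(* The integrals below run over {t1..t}, so J_fun and I_minus denote the usual expressions
   for t1 \<le> t, the only range of arguments that occurs in the bounds. *)

definition J_fun :: "(real \<Rightarrow> real) \<Rightarrow> real \<Rightarrow> real \<Rightarrow> real" where
  "J_fun u t1 t = exp (integral {t1..t} u)"

definition I_minus :: "(real \<Rightarrow> real) \<Rightarrow> (real \<Rightarrow> real) \<Rightarrow> real \<Rightarrow> real \<Rightarrow> real" where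
  "I_minus u v t1 t = integral {t1..t} (\<lambda>\<tau>. J_fun (\<lambda>s. - u s) \<tau> t * v \<tau>)"

definition unbounded_support :: "real \<Rightarrow> (real \<Rightarrow> real) \<Rightarrow> bool" where
  "unbounded_support t0 f \<longleftrightarrow> \<not> bounded (closure (support_on {t0..} f))"

(* The derivative is taken within the half-line, hence it is the right derivative at t0. *)
definition linear_system_solution ::
  "(real \<Rightarrow> real) \<Rightarrow> (real \<Rightarrow> real) \<Rightarrow> (real \<Rightarrow> real) \<Rightarrow> (real \<Rightarrow> real) \<Rightarrow> real
    \<Rightarrow> (real \<Rightarrow> real) \<Rightarrow> (real \<Rightarrow> real) \<Rightarrow> bool" where
  "linear_system_solution a11 a12 a21 a22 t0 \<phi> \<psi> \<longleftrightarrow>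
    (\<forall>t\<ge>t0.
      (\<phi> has_real_derivative a11 t * \<phi> t + a12 t * \<psi> t) (at t within {t0..}) \<and>
      (\<psi> has_real_derivative a21 t * \<phi> t + a22 t * \<psi> t) (at t within {t0..}))"

end

theory Submission
  imports Defs
begin

text \<open>
  Along a solution with positive \<open>\<phi>\<close>, the quotient \<open>y = \<psi> / \<phi>\<close> satisfies the Riccati equation
  \<open>y' = a21 - B * y - a12 * y\<^sup>2\<close>, and \<open>\<phi>' = (a11 + a12 * y) * \<phi>\<close>. Dropping the quadratic term leaves a
  linear equation whose solution with value \<open>0\<close> at \<open>t0\<close> is \<open>I = I_minus B a21 t0\<close>. Hence
  \<open>X = exp (\<integral> a11 + a12 * I)\<close>, the right-hand side of the first bound, together with \<open>Y = I * X\<close>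
  satisfies the first equation of the system exactly and the second one up to the nonnegative
  excess \<open>a12 * I\<^sup>2 * X\<close>: the pair \<open>(X, Y)\<close> is a supersolution.

  Since \<open>a12\<close> and \<open>a21\<close> are nonnegative, the system is cooperative, so a supersolution that
  dominates a solution componentwise at one time dominates it from then on
  (\<open>cooperative_system_nonneg\<close>). At \<open>t0\<close> itself \<open>Y\<close> vanishes and no multiple of \<open>(X, Y)\<close> need
  dominate \<open>(\<phi>, \<psi>)\<close>; but \<open>a21\<close> is not identically zero, so \<open>I\<close>, and with it \<open>Y\<close>, is positive at
  some later time \<open>t1\<close> (\<open>I_minus_pos\<close>). A large multiple of \<open>(X, Y)\<close> then dominates both
  \<open>(\<phi>, \<psi>)\<close> and \<open>(-\<phi>, -\<psi>)\<close> at \<open>t1\<close>, hence afterwards, and compactness of \<open>{t0..t1}\<close> takes care of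
  the times before \<open>t1\<close>. The second bound is the first one for the system with the two unknowns
  exchanged, which turns \<open>B\<close> into \<open>-B\<close>.
\<close>

section \<open>A comparison principle for cooperative planar systems\<close>

text \<open>
  Squaring removes the kink of the negative part at \<open>0\<close>, which makes it usable in an energy argument.
\<close>

lemma has_real_derivative_min_zero_square:
  fixes u :: "real \<Rightarrow> real"
  assumes "(u has_real_derivative u') (at t within S)"
  shows "((\<lambda>t. (min (u t) 0)\<^sup>2) has_real_derivative 2 * min (u t) 0 * u') (at t within S)"
proof -
  have "((\<lambda>v. (min v 0)\<^sup>2) has_real_derivative 2 * min w 0) (at w)" for w :: real
  proof -
    consider "w < 0" | "w = 0" | "w > 0" by linarith
    then show ?thesis
    proof cases
      case 1
      have "((\<lambda>v. v\<^sup>2) has_real_derivative 2 * min w 0) (at w)"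
        using 1 by (auto intro!: derivative_eq_intros)
      then show ?thesis
        by (rule has_field_derivative_transform_within_open[where S = "{..<0}"]) (use 1 in auto)
    next
      case 2
      have "((\<lambda>h::real. \<bar>h\<bar>) \<longlongrightarrow> 0) (at 0)"
        by (intro tendsto_rabs_zero tendsto_ident_at)
      then have "((\<lambda>h. (min h 0)\<^sup>2 / h) \<longlongrightarrow> (0::real)) (at 0)"
        by (rule Lim_null_comparison[rotated])
           (auto intro!: always_eventually simp: min_def power2_eq_square)
      then show ?thesis
        using 2 by (simp add: DERIV_def)
    next
      case 3
      have "((\<lambda>v. 0) has_real_derivative 2 * min w 0) (at w)"
        using 3 by (auto intro!: derivative_eq_intros)
      then show ?thesis
        by (rule has_field_derivative_transform_within_open[where S = "{0<..}"]) (use 3 in auto)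
    qed
  qed
  then show ?thesis
    using DERIV_chain2[OF _ assms] by blast
qed

text \<open>
  Let \<open>p\<close> and \<open>q\<close> be the negative parts of \<open>x\<close> and \<open>y\<close> (with values \<open>\<le> 0\<close>), and let \<open>E = p\<^sup>2 + q\<^sup>2\<close>.
  The differential inequalities, multiplied by \<open>p\<close> and \<open>q\<close>, bound \<open>E'\<close>. The coupling terms
  \<open>b * p * y\<close> and \<open>c * q * x\<close> are the only ones that could involve the positive parts, and these
  parts contribute with a favourable sign because \<open>b\<close> and \<open>c\<close> are nonnegative. Thus \<open>E' \<le> K * E\<close>, and
  \<open>E\<close> stays zero by Gronwall's argument.
\<close>

lemma cooperative_system_nonneg:
  fixes a b c d x y x' y' :: "real \<Rightarrow> real"
  assumes "s \<le> t"
    and cont: "continuous_on {s..t} a" "continuous_on {s..t} b"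
      "continuous_on {s..t} c" "continuous_on {s..t} d"
    and b: "\<And>u. u \<in> {s..t} \<Longrightarrow> 0 \<le> b u" and c: "\<And>u. u \<in> {s..t} \<Longrightarrow> 0 \<le> c u"
    and x: "\<And>u. u \<in> {s..t} \<Longrightarrow> (x has_real_derivative x' u) (at u within {s..t})"
    and y: "\<And>u. u \<in> {s..t} \<Longrightarrow> (y has_real_derivative y' u) (at u within {s..t})"
    and x': "\<And>u. u \<in> {s..t} \<Longrightarrow> a u * x u + b u * y u \<le> x' u"
    and y': "\<And>u. u \<in> {s..t} \<Longrightarrow> c u * x u + d u * y u \<le> y' u"
    and init: "0 \<le> x s" "0 \<le> y s"
  shows "0 \<le> x t \<and> 0 \<le> y t"
proof -
  define p q where "p u = min (x u) 0" and "q u = min (y u) 0" for u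
  define E where "E u = (p u)\<^sup>2 + (q u)\<^sup>2" for u
  define E' where "E' u = 2 * p u * x' u + 2 * q u * y' u" for u
  define k where "k u = 2 * (\<bar>a u\<bar> + \<bar>b u\<bar> + \<bar>c u\<bar> + \<bar>d u\<bar>)" for u
  have "continuous_on {s..t} k"
    unfolding k_def by (intro continuous_intros cont)
  then obtain K where K: "\<And>u. u \<in> {s..t} \<Longrightarrow> k u \<le> K"
    using continuous_attains_sup[of "{s..t}" k] \<open>s \<le> t\<close> by fastforce
  have E: "(E has_real_derivative E' u) (at u within {s..t})" if "u \<in> {s..t}" for u
    unfolding E_def E'_def p_def q_def using x[OF that] y[OF that]
    by (intro DERIV_add has_real_derivative_min_zero_square)
  have E'_le: "E' u \<le> K * E u" if u: "u \<in> {s..t}" for u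
  proof -
    have px: "p u * x u = (p u)\<^sup>2" and qy: "q u * y u = (q u)\<^sup>2"
      by (auto simp: p_def q_def min_def power2_eq_square)
    have py: "p u * y u \<le> p u * q u" and qx: "q u * x u \<le> p u * q u"
      by (auto simp: p_def q_def min_def mult_le_0_iff zero_le_mult_iff mult.commute)
    have pq: "2 * (p u * q u) \<le> E u"
      unfolding E_def using sum_squares_bound[of "p u" "q u"] by simp
    have "p u * x' u \<le> p u * (a u * x u + b u * y u)"
      using x'[OF u] by (intro mult_left_mono_neg) (auto simp: p_def)
    also have "\<dots> = a u * (p u)\<^sup>2 + b u * (p u * y u)"
      by (simp add: algebra_simps flip: px)
    also have "\<dots> \<le> \<bar>a u\<bar> * E u + b u * (p u * q u)"
      by (intro add_mono mult_mono mult_left_mono py b u) (auto simp: E_def)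
    finally have 1: "p u * x' u \<le> \<bar>a u\<bar> * E u + b u * (p u * q u)" .
    have "q u * y' u \<le> q u * (c u * x u + d u * y u)"
      using y'[OF u] by (intro mult_left_mono_neg) (auto simp: q_def)
    also have "\<dots> = d u * (q u)\<^sup>2 + c u * (q u * x u)"
      by (simp add: algebra_simps flip: qy)
    also have "\<dots> \<le> \<bar>d u\<bar> * E u + c u * (p u * q u)"
      by (intro add_mono mult_mono mult_left_mono qx c u) (auto simp: E_def)
    finally have 2: "q u * y' u \<le> \<bar>d u\<bar> * E u + c u * (p u * q u)" .
    have 3: "b u * (2 * (p u * q u)) \<le> b u * E u" "c u * (2 * (p u * q u)) \<le> c u * E u"
      by (intro mult_left_mono pq b c u)+
    have 4: "0 \<le> E u" by (simp add: E_def)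
    then have 5: "0 \<le> b u * E u" "0 \<le> c u * E u" using b[OF u] c[OF u] by auto
    have "E' u \<le> k u * E u"
      using 1 2 3 5 b[OF u] c[OF u] by (simp add: E'_def k_def algebra_simps)
    also have "\<dots> \<le> K * E u"
      by (intro mult_right_mono K u 4)
    finally show ?thesis .
  qed
  \<comment> \<open>The integrating factor turns \<open>E' \<le> K * E\<close> into monotonicity.\<close>
  define F where "F u = exp (- K * u) * E u" for u
  have F: "(F has_real_derivative exp (- K * u) * (E' u - K * E u)) (at u within {s..t})"
    if "u \<in> {s..t}" for u
    unfolding F_def by (auto intro!: derivative_eq_intros E that simp: algebra_simps)
  obtain u where u: "u \<in> {s..t}"
    "F t - F s = exp (- K * u) * (E' u - K * E u) * (t - s)"
    using mvt_very_simple[OF \<open>s \<le> t\<close>, of F "\<lambda>u h. exp (- K * u) * (E' u - K * E u) * h"]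
      F[unfolded has_field_derivative_def] by auto
  have "F t - F s \<le> 0"
    unfolding u(2) using E'_le[OF u(1)] \<open>s \<le> t\<close>
    by (intro mult_nonpos_nonneg mult_nonneg_nonpos) auto
  moreover have "F s = 0"
    using init by (simp add: F_def E_def p_def q_def)
  ultimately have "E t \<le> 0"
    by (simp add: F_def mult_le_0_iff)
  then have "(p t)\<^sup>2 + (q t)\<^sup>2 = 0"
    by (simp add: E_def sum_power2_le_zero_iff)
  then show ?thesis
    by (auto simp: sum_power2_eq_zero_iff p_def q_def min_def split: if_splits)
qed

section \<open>The supersolution built from the linearised Riccati equation\<close>

text \<open>
  The derivative is taken within the whole half-line, to match the notion of solution and to keep
  the right endpoint of an auxiliary interval out of the later arguments.
\<close>

lemma integral_has_real_derivative_atLeast: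
  fixes f :: "real \<Rightarrow> real"
  assumes "continuous_on {t0..} f" "t0 \<le> t"
  shows "((\<lambda>t. integral {t0..t} f) has_real_derivative f t) (at t within {t0..})"
proof -
  have "((\<lambda>t. integral {t0..t} f) has_real_derivative f t) (at t within {t0..t+1})"
    using assms by (intro integral_has_real_derivative continuous_on_subset[OF assms(1)]) auto
  moreover have "at t within {t0..} = at t within {t0..t+1}"
    by (rule at_within_nhd[where S = "{..<t+1}"]) auto
  ultimately show ?thesis by simp
qed

text \<open>
  In the definition of \<^const>\<open>I_minus\<close> the upper limit \<open>t\<close> also occurs in the integrand; splitting
  the inner integral at \<open>\<tau>\<close> moves this dependence into a factor in front, so that the fundamental
  theorem of calculus applies.
\<close>

lemma I_minus_eq:
  assumes "continuous_on {t0..} u" "t0 \<le> t"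
  shows "I_minus u v t0 t =
    exp (- integral {t0..t} u) * integral {t0..t} (\<lambda>\<tau>. exp (integral {t0..\<tau>} u) * v \<tau>)"
proof -
  have int: "u integrable_on {t0..t}"
    using assms by (intro integrable_continuous_real continuous_on_subset[OF assms(1)]) auto
  have "J_fun (\<lambda>s. - u s) \<tau> t * v \<tau> =
    exp (- integral {t0..t} u) * (exp (integral {t0..\<tau>} u) * v \<tau>)" if "\<tau> \<in> {t0..t}" for \<tau>
  proof -
    have "integral {t0..\<tau>} u + integral {\<tau>..t} u = integral {t0..t} u"
      using that int by (intro Henstock_Kurzweil_Integration.integral_combine) auto
    then have "integral {\<tau>..t} (\<lambda>s. - u s) = - integral {t0..t} u + integral {t0..\<tau>} u"
      by simp
    then show ?thesis
      unfolding J_fun_def by (simp only: exp_add mult.assoc)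
  qed
  then have "I_minus u v t0 t =
    integral {t0..t} (\<lambda>\<tau>. exp (- integral {t0..t} u) * (exp (integral {t0..\<tau>} u) * v \<tau>))"
    unfolding I_minus_def by (rule integral_cong)
  then show ?thesis by simp
qed

lemma continuous_on_exp_integral_mult:
  fixes u v :: "real \<Rightarrow> real"
  assumes "continuous_on {t0..} u" "continuous_on {t0..} v"
  shows "continuous_on {t0..} (\<lambda>\<tau>. exp (integral {t0..\<tau>} u) * v \<tau>)"
proof -
  have "continuous_on {t0..} (\<lambda>\<tau>. integral {t0..\<tau>} u)"
    by (rule DERIV_continuous_on[OF integral_has_real_derivative_atLeast[OF assms(1)]]) auto
  then show ?thesis
    by (intro continuous_intros assms)
qed

text \<open>
  Variation of constants: \<^const>\<open>I_minus\<close> solves the linearised Riccati equation \<open>y' = v - u * y\<close>.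
\<close>

lemma I_minus_has_real_derivative:
  assumes u: "continuous_on {t0..} u" and v: "continuous_on {t0..} v" and t: "t0 \<le> t"
  shows "(I_minus u v t0 has_real_derivative v t - u t * I_minus u v t0 t) (at t within {t0..})"
proof -
  let ?H = "\<lambda>t. exp (- integral {t0..t} u) * integral {t0..t} (\<lambda>\<tau>. exp (integral {t0..\<tau>} u) * v \<tau>)"
  have "(?H has_real_derivative v t - u t * I_minus u v t0 t) (at t within {t0..})"
    by (rule derivative_eq_intros integral_has_real_derivative_atLeast u t
        continuous_on_exp_integral_mult v refl)+
      (simp add: I_minus_eq[OF u t] exp_minus)
  then show ?thesis
    by (rule has_field_derivative_transform_within[where d = 1]) (use t I_minus_eq[OF u] in auto)
qed

lemma I_minus_pos:
  assumes u: "continuous_on {t0..} u" and v: "continuous_on {t0..} v"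
    and nn: "\<And>t. t0 \<le> t \<Longrightarrow> 0 \<le> v t"
    and s: "t0 \<le> s" "v s \<noteq> 0" "s < t"
  shows "0 < I_minus u v t0 t"
proof -
  let ?h = "\<lambda>\<tau>. exp (integral {t0..\<tau>} u) * v \<tau>"
  have cont: "continuous_on {t0..t} ?h"
    by (rule continuous_on_subset[OF continuous_on_exp_integral_mult[OF u v]]) auto
  have "integral {t0..t} ?h \<noteq> 0"
    using integral_eq_0_iff[OF cont] nn s by force
  moreover have "0 \<le> integral {t0..t} ?h"
    using nn by (intro integral_nonneg integrable_continuous_real cont) auto
  ultimately show ?thesis
    using s by (simp add: I_minus_eq[OF u] zero_less_mult_iff)
qed

section \<open>Bounds for the components of a solution\<close>

text \<open>
  The coefficients are generic: exchanging the roles of the two equations yields the bound for the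
  second component. The factor \<open>I\<close> in \<open>Y = I * X\<close> is the solution of the linearised Riccati equation,
  and the discarded quadratic term reappears as the excess in the inequality for \<open>Y\<close>.
\<close>

lemma component_bound:
  fixes a b c d x y :: "real \<Rightarrow> real"
  assumes a: "continuous_on {t0..} a" and b: "continuous_on {t0..} b"
    and c: "continuous_on {t0..} c" and d: "continuous_on {t0..} d"
    and supp: "unbounded_support t0 c"
    and b_nn: "\<And>t. t0 \<le> t \<Longrightarrow> 0 \<le> b t" and c_nn: "\<And>t. t0 \<le> t \<Longrightarrow> 0 \<le> c t"
    and sol: "linear_system_solution a b c d t0 x y"
  shows "\<exists>C. \<forall>t\<ge>t0. \<bar>x t\<bar> \<le>
    C * exp (integral {t0..t} (\<lambda>\<tau>. a \<tau> + b \<tau> * I_minus (\<lambda>s. a s - d s) c t0 \<tau>))"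
proof -
  define I where "I = I_minus (\<lambda>s. a s - d s) c t0"
  define X where "X t = exp (integral {t0..t} (\<lambda>\<tau>. a \<tau> + b \<tau> * I \<tau>))" for t
  define Y where "Y t = I t * X t" for t
  have B: "continuous_on {t0..} (\<lambda>s. a s - d s)"
    by (intro continuous_intros a d)
  have I': "(I has_real_derivative c t - (a t - d t) * I t) (at t within {t0..})" if "t0 \<le> t" for t
    unfolding I_def by (rule I_minus_has_real_derivative[OF B c that])
  have "continuous_on {t0..} I"
    by (rule DERIV_continuous_on[OF I']) auto
  then have X': "(X has_real_derivative a t * X t + b t * Y t) (at t within {t0..})"
    if "t0 \<le> t" for t
    unfolding X_def Y_def using that
    by (auto intro!: derivative_eq_intros integral_has_real_derivative_atLeast continuous_intros a b
        simp: algebra_simps)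
  have Y': "(Y has_real_derivative c t * X t + d t * Y t + b t * (I t)\<^sup>2 * X t) (at t within {t0..})"
    if "t0 \<le> t" for t
  proof -
    have "Y = (\<lambda>t. I t * X t)"
      by (simp add: Y_def fun_eq_iff)
    then show ?thesis
      using DERIV_mult[OF I'[OF that] X'[OF that]]
      by (simp add: algebra_simps power2_eq_square)
  qed
  have X_pos: "0 < X t" for t
    by (simp add: X_def)
  have x': "(x has_real_derivative a t * x t + b t * y t) (at t within {t0..})"
    and y': "(y has_real_derivative c t * x t + d t * y t) (at t within {t0..})" if "t0 \<le> t" for t
    using sol that by (auto simp: linear_system_solution_def)

  obtain s where s: "t0 \<le> s" "c s \<noteq> 0"
  proof -
    have "support_on {t0..} c \<noteq> {}"
      using supp by (auto simp: unbounded_support_def)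
    then show ?thesis
      using that by (auto simp: support_on_def)
  qed
  \<comment> \<open>Any time after \<open>s\<close> serves: there \<open>I\<close>, and hence \<open>Y\<close>, is strictly positive.\<close>
  define t1 where "t1 = s + 1"
  have t1: "t0 \<le> t1" using s by (simp add: t1_def)
  have "0 < I t1"
    unfolding I_def using s by (intro I_minus_pos[OF B c c_nn]) (auto simp: t1_def)
  then have Y_pos: "0 < Y t1"
    by (simp add: Y_def X_pos)

  have "continuous_on {t0..} (\<lambda>t. \<bar>x t\<bar> / X t)"
    using X_pos DERIV_continuous_on[of "{t0..}", OF x'] DERIV_continuous_on[of "{t0..}", OF X']
    by (intro continuous_intros) (auto simp: less_imp_neq[symmetric])
  then have "continuous_on {t0..t1} (\<lambda>t. \<bar>x t\<bar> / X t)"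
    by (rule continuous_on_subset) auto
  then obtain M where M: "\<And>t. t \<in> {t0..t1} \<Longrightarrow> \<bar>x t\<bar> / X t \<le> M"
    using continuous_attains_sup[of "{t0..t1}" "\<lambda>t. \<bar>x t\<bar> / X t"] t1 by fastforce
  define C where "C = max M (\<bar>y t1\<bar> / Y t1)"
  have early: "\<bar>x t\<bar> \<le> C * X t" if "t \<in> {t0..t1}" for t
    using M[OF that] X_pos[of t] by (auto simp: C_def simp flip: pos_divide_le_eq)
  have y1: "\<bar>y t1\<bar> \<le> C * Y t1"
    using Y_pos by (auto simp: C_def simp flip: pos_divide_le_eq)
  have "0 \<le> C"
    using Y_pos by (simp add: C_def le_max_iff_disj)

  \<comment> \<open>The two signs \<open>\<sigma>\<close> give the upper and the lower bound for \<open>x t\<close>.\<close>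
  have late: "\<sigma> * x t \<le> C * X t" if "t1 \<le> t" "\<sigma> = 1 \<or> \<sigma> = - 1" for t \<sigma> :: real
  proof -
    have sub: "{t1..t} \<subseteq> {t0..}" using t1 by auto
    have "0 \<le> C * X t - \<sigma> * x t \<and> 0 \<le> C * Y t - \<sigma> * y t"
    proof (rule cooperative_system_nonneg[where s = t1 and a = a and b = b and c = c and d = d
          and x = "\<lambda>u. C * X u - \<sigma> * x u"
          and x' = "\<lambda>u. C * (a u * X u + b u * Y u) - \<sigma> * (a u * x u + b u * y u)"
          and y = "\<lambda>u. C * Y u - \<sigma> * y u"
          and y' = "\<lambda>u. C * (c u * X u + d u * Y u + b u * (I u)\<^sup>2 * X u)
            - \<sigma> * (c u * x u + d u * y u)"])
      fix u assume u: "u \<in> {t1..t}"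
      then have u0: "t0 \<le> u" using t1 by auto
      note w = DERIV_subset[OF _ sub]
      show "((\<lambda>t. C * X t - \<sigma> * x t) has_real_derivative
          C * (a u * X u + b u * Y u) - \<sigma> * (a u * x u + b u * y u)) (at u within {t1..t})"
        by (intro DERIV_diff DERIV_cmult w X' x' u0)
      show "((\<lambda>t. C * Y t - \<sigma> * y t) has_real_derivative
          C * (c u * X u + d u * Y u + b u * (I u)\<^sup>2 * X u) - \<sigma> * (c u * x u + d u * y u))
          (at u within {t1..t})"
        by (intro DERIV_diff DERIV_cmult w Y' y' u0)
      show "a u * (C * X u - \<sigma> * x u) + b u * (C * Y u - \<sigma> * y u)
          \<le> C * (a u * X u + b u * Y u) - \<sigma> * (a u * x u + b u * y u)"
        by (simp add: algebra_simps)
      have "0 \<le> C * (b u * (I u)\<^sup>2 * X u)"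
        using \<open>0 \<le> C\<close> b_nn[OF u0] X_pos[of u] by simp
      then show "c u * (C * X u - \<sigma> * x u) + d u * (C * Y u - \<sigma> * y u)
          \<le> C * (c u * X u + d u * Y u + b u * (I u)\<^sup>2 * X u) - \<sigma> * (c u * x u + d u * y u)"
        by (simp add: algebra_simps)
      show "0 \<le> b u" "0 \<le> c u" using b_nn c_nn u0 by auto
    next
      show "0 \<le> C * X t1 - \<sigma> * x t1" "0 \<le> C * Y t1 - \<sigma> * y t1"
        using early[of t1] y1 t1 that(2) by auto
    qed (use \<open>t1 \<le> t\<close> in \<open>auto intro: continuous_on_subset[OF _ sub] a b c d\<close>)
    then show ?thesis by simp
  qed
  have "\<bar>x t\<bar> \<le> C * X t" if "t0 \<le> t" for t
    using early[of t] late[of t 1] late[of t "-1"] that by (cases "t \<le> t1") auto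
  then show ?thesis
    unfolding X_def I_def by blast
qed

theorem mainTheorem8:
  fixes a11 a12 a21 a22 :: "real \<Rightarrow> real" and t0 :: real and B :: "real \<Rightarrow> real"
    and \<phi> \<psi> :: "real \<Rightarrow> real"
  defines "B \<equiv> (\<lambda>t. a11 t - a22 t)"
  assumes "continuous_on {t0..} a11" and "continuous_on {t0..} a12"
    and "continuous_on {t0..} a21" and "continuous_on {t0..} a22"
    and "unbounded_support t0 a12" and "unbounded_support t0 a21"
    and "\<And>t. t \<ge> t0 \<Longrightarrow> a12 t \<ge> 0" and "\<And>t. t \<ge> t0 \<Longrightarrow> a21 t \<ge> 0"
    and "linear_system_solution a11 a12 a21 a22 t0 \<phi> \<psi>"
  shows "\<exists>C1 C2 :: real. \<forall>t\<ge>t0.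
    \<bar>\<phi> t\<bar> \<le> C1 * exp (integral {t0..t} (\<lambda>\<tau>. a11 \<tau> + a12 \<tau> * I_minus B a21 t0 \<tau>)) \<and>
    \<bar>\<psi> t\<bar> \<le> C2 * exp (integral {t0..t} (\<lambda>\<tau>. a22 \<tau> + a21 \<tau> * I_minus (\<lambda>s. - B s) a12 t0 \<tau>))"
proof -
  have sol: "linear_system_solution a22 a21 a12 a11 t0 \<psi> \<phi>"
    using assms(10) by (simp add: linear_system_solution_def add.commute)
  have mB: "(\<lambda>s. - B s) = (\<lambda>s. a22 s - a11 s)"
    by (simp add: B_def)
  obtain C1 where C1: "\<forall>t\<ge>t0. \<bar>\<phi> t\<bar> \<le>
      C1 * exp (integral {t0..t} (\<lambda>\<tau>. a11 \<tau> + a12 \<tau> * I_minus B a21 t0 \<tau>))"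
    using component_bound[OF assms(2-5) assms(7-10)] unfolding B_def by blast
  obtain C2 where C2: "\<forall>t\<ge>t0. \<bar>\<psi> t\<bar> \<le>
      C2 * exp (integral {t0..t} (\<lambda>\<tau>. a22 \<tau> + a21 \<tau> * I_minus (\<lambda>s. - B s) a12 t0 \<tau>))"
    using component_bound[OF assms(5) assms(4) assms(3) assms(2) assms(6) assms(9) assms(8) sol]
    unfolding mB by blast
  show ?thesis
    using C1 C2 by blast
qed

end
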